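(* There exists a Fraïssé class $\mathcal{F}$ in a finite relational signature such that the automorphism group of its Fraïssé limit is torsion-free, while the class of automorphism groups of the finite substructures of the Fraïssé limit contains (up to isomorphism) all finite symmetric groups, i.e. for every $n\in\omega$ there is a finite substructure $X$ of the Fraïssé limit with $\operatorname{Aut}(X)$ isomorphic to the symmetric group $S_n$.
   Context: A class $\mathcal{F}$ of finitely generated models of a first-order language is a Fraïssé class if it is hereditary, has the joint embedding property, has countably many isomorphism types, and has the amalgamation property. A relational signature consists of relation symbols only (no constants, no function symbols); finitely generated models are then finite, and the empty set is allowed as a model. The Fraïssé limit of $\mathcal{F}$ is the unique (up to isomorphism) countable homogeneous structure whose age (the class of all finitely generated structures embeddable into it) is $\mathcal{F}$. A group is torsion-free if it has no non-identity element of finite order. *)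

theory Defs
  imports "HOL-Algebra.Bij" "HOL-Algebra.Sym_Groups" "HOL-Library.Countable_Set"
begin

record signature =
  symbols :: "nat set"
  arity :: "nat \<Rightarrow> nat"

definition finite_relational_signature :: "signature \<Rightarrow> bool" where
  "finite_relational_signature L \<longleftrightarrow>
     finite (symbols L) \<and> (\<forall>r\<in>symbols L. arity L r > 0)"

record 'a rel_model =
  univ :: "'a set"
  rel :: "nat \<Rightarrow> 'a list set"

text \<open>The universe may be empty. Symbols outside the signature are interpreted by the empty set, so
  that a model carries no information beyond its signature.\<close>

definition is_model :: "signature \<Rightarrow> 'a rel_model \<Rightarrow> bool" where
  "is_model L A \<longleftrightarrow>
     (\<forall>r\<in>symbols L. rel A r \<subseteq> {xs. length xs = arity L r \<and> set xs \<subseteq> univ A}) \<and>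
     (\<forall>r. r \<notin> symbols L \<longrightarrow> rel A r = {})"

definition induced :: "'a rel_model \<Rightarrow> 'a set \<Rightarrow> 'a rel_model" where
  "induced A X = \<lparr>univ = X, rel = (\<lambda>r. {xs \<in> rel A r. set xs \<subseteq> X})\<rparr>"

definition embedding ::
  "signature \<Rightarrow> 'a rel_model \<Rightarrow> 'b rel_model \<Rightarrow> ('a \<Rightarrow> 'b) \<Rightarrow> bool" where
  "embedding L A B f \<longleftrightarrow>
     f ` univ A \<subseteq> univ B \<and> inj_on f (univ A) \<and>
     (\<forall>r\<in>symbols L. \<forall>xs. length xs = arity L r \<and> set xs \<subseteq> univ A \<longrightarrow>
        (xs \<in> rel A r \<longleftrightarrow> map f xs \<in> rel B r))"

definition isomorphism ::
  "signature \<Rightarrow> 'a rel_model \<Rightarrow> 'b rel_model \<Rightarrow> ('a \<Rightarrow> 'b) \<Rightarrow> bool" where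
  "isomorphism L A B f \<longleftrightarrow> embedding L A B f \<and> f ` univ A = univ B"

definition embeddable :: "signature \<Rightarrow> 'a rel_model \<Rightarrow> 'b rel_model \<Rightarrow> bool" where
  "embeddable L A B \<longleftrightarrow> (\<exists>f. embedding L A B f)"

definition isomorphic :: "signature \<Rightarrow> 'a rel_model \<Rightarrow> 'b rel_model \<Rightarrow> bool" where
  "isomorphic L A B \<longleftrightarrow> (\<exists>f. isomorphism L A B f)"

text \<open>In a relational signature the finitely generated models are the finite ones. Every finite model
  is isomorphic to one whose universe is a finite set of natural numbers, so a class of finitely
  generated models is represented by a set of models over \<^typ>\<open>nat\<close>. The hereditary property below
  makes that set closed under isomorphism.\<close>

definition finite_models :: "signature \<Rightarrow> 'a rel_model set" where
  "finite_models L = {A. is_model L A \<and> finite (univ A)}"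

definition hereditary :: "signature \<Rightarrow> nat rel_model set \<Rightarrow> bool" where
  "hereditary L F \<longleftrightarrow> (\<forall>B\<in>F. \<forall>A\<in>finite_models L. embeddable L A B \<longrightarrow> A \<in> F)"

definition joint_embedding_property :: "signature \<Rightarrow> nat rel_model set \<Rightarrow> bool" where
  "joint_embedding_property L F \<longleftrightarrow>
     (\<forall>A\<in>F. \<forall>B\<in>F. \<exists>C\<in>F. embeddable L A C \<and> embeddable L B C)"

definition amalgamation_property :: "signature \<Rightarrow> nat rel_model set \<Rightarrow> bool" where
  "amalgamation_property L F \<longleftrightarrow>
     (\<forall>A\<in>F. \<forall>B\<in>F. \<forall>C\<in>F. \<forall>f g. embedding L A B f \<and> embedding L A C g \<longrightarrow>
        (\<exists>D\<in>F. \<exists>f' g'. embedding L B D f' \<and> embedding L C D g' \<and>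
           (\<forall>x\<in>univ A. f' (f x) = g' (g x))))"

definition countably_many_isomorphism_types :: "signature \<Rightarrow> nat rel_model set \<Rightarrow> bool" where
  "countably_many_isomorphism_types L F \<longleftrightarrow>
     countable (F // {(A, B). A \<in> F \<and> B \<in> F \<and> isomorphic L A B})"

definition fraisse_class :: "signature \<Rightarrow> nat rel_model set \<Rightarrow> bool" where
  "fraisse_class L F \<longleftrightarrow>
     F \<subseteq> finite_models L \<and> hereditary L F \<and> joint_embedding_property L F \<and>
     countably_many_isomorphism_types L F \<and> amalgamation_property L F"

definition age :: "signature \<Rightarrow> 'a rel_model \<Rightarrow> nat rel_model set" where
  "age L M = {A \<in> finite_models L. embeddable L A M}"

definition homogeneous :: "signature \<Rightarrow> 'a rel_model \<Rightarrow> bool" where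
  "homogeneous L M \<longleftrightarrow>
     (\<forall>X Y f. X \<subseteq> univ M \<and> finite X \<and> Y \<subseteq> univ M \<and> finite Y \<and>
        isomorphism L (induced M X) (induced M Y) f \<longrightarrow>
        (\<exists>g. isomorphism L M M g \<and> (\<forall>x\<in>X. g x = f x)))"

definition fraisse_limit :: "signature \<Rightarrow> nat rel_model set \<Rightarrow> 'a rel_model \<Rightarrow> bool" where
  "fraisse_limit L F M \<longleftrightarrow>
     is_model L M \<and> countable (univ M) \<and> homogeneous L M \<and> age L M = F"

text \<open>As in \<^const>\<open>BijGroup\<close>, automorphisms are extensional functions on the universe, so that
  maps agreeing on the universe are equal.\<close>

definition automorphism_group :: "signature \<Rightarrow> 'a rel_model \<Rightarrow> ('a \<Rightarrow> 'a) monoid" where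
  "automorphism_group L A =
     BijGroup (univ A) \<lparr>carrier := {f \<in> Bij (univ A). isomorphism L A A f}\<rparr>"

definition torsion_free :: "('a, 'b) monoid_scheme \<Rightarrow> bool" where
  "torsion_free G \<longleftrightarrow>
     (\<forall>x\<in>carrier G. \<forall>n::nat. n > 0 \<and> x [^]\<^bsub>G\<^esub> n = \<one>\<^bsub>G\<^esub> \<longrightarrow> x = \<one>\<^bsub>G\<^esub>)"

end

theory Submission
  imports Defs "HOL-Analysis.Continuum_Not_Denumerable"
begin

text \<open>Consider finite structures consisting of a set \<open>P\<close>, a linearly ordered set \<open>Q\<close> and an
  arbitrary relation between \<open>P\<close> and \<open>Q\<close>. An automorphism of finite order of the limit fixes \<open>Q\<close>
  pointwise, because a linear order has no nontrivial automorphism of finite order. In the limit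
  any two points of \<open>P\<close> are separated by a point of \<open>Q\<close>, so the automorphism is the identity. On
  the other hand \<open>n\<close> points of \<open>P\<close> form a substructure without any relations, whose automorphism
  group is the full symmetric group.

  The limit is built explicitly on a countable dense set of reals in the manner of the random graph;
  a back-and-forth argument gives its homogeneity, and amalgamation for its age follows from
  homogeneity.\<close>

section \<open>Ages of homogeneous structures\<close>

lemma induced_simps [simp]:
  "univ (induced A X) = X" "rel (induced A X) r = {xs \<in> rel A r. set xs \<subseteq> X}"
  by (simp_all add: induced_def)

lemma embedding_image: "embedding L A B f \<Longrightarrow> f ` univ A \<subseteq> univ B"
  and embedding_inj_on: "embedding L A B f \<Longrightarrow> inj_on f (univ A)"
  by (simp_all add: embedding_def)

lemma embedding_comp:
  assumes "embedding L A B f" "embedding L B C g"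
  shows "embedding L A C (g \<circ> f)"
  unfolding embedding_def
proof (intro conjI ballI allI impI)
  show "(g \<circ> f) ` univ A \<subseteq> univ C" "inj_on (g \<circ> f) (univ A)"
    using assms by (auto simp: embedding_def inj_on_def image_subset_iff)
next
  fix r xs assume r: "r \<in> symbols L" and xs: "length xs = arity L r \<and> set xs \<subseteq> univ A"
  then have "length (map f xs) = arity L r" "set (map f xs) \<subseteq> univ B"
    using assms(1) by (auto simp: embedding_def)
  then show "xs \<in> rel A r \<longleftrightarrow> map (g \<circ> f) xs \<in> rel C r"
    using assms r xs unfolding embedding_def by (metis map_map)
qed

lemma embedding_induced:
  assumes "embedding L A M f" "f ` univ A \<subseteq> X"
  shows "embedding L A (induced M X) f"
  using assms unfolding embedding_def by (auto simp: image_subset_iff subset_iff)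

text \<open>Composed with a second embedding of \<open>A\<close> into \<open>M\<close>, this inverse
  yields an isomorphism between two finite substructures of \<open>M\<close>, which is the form of
  input that homogeneity accepts.\<close>

lemma embedding_inv:
  assumes "embedding L A M f"
  shows "embedding L (induced M (f ` univ A)) A (inv_into (univ A) f)"
  unfolding embedding_def
proof (intro conjI ballI allI impI)
  show "inv_into (univ A) f ` univ (induced M (f ` univ A)) \<subseteq> univ A"
    by (auto intro: inv_into_into)
  show "inj_on (inv_into (univ A) f) (univ (induced M (f ` univ A)))"
    by (simp add: inj_on_inv_into)
next
  fix r xs assume r: "r \<in> symbols L"
    and xs: "length xs = arity L r \<and> set xs \<subseteq> univ (induced M (f ` univ A))"
  define ys where "ys = map (inv_into (univ A) f) xs"
  have "set ys \<subseteq> univ A" "length ys = arity L r"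
    using xs by (auto simp: ys_def intro: inv_into_into)
  moreover have "map f ys = xs"
    using xs unfolding ys_def map_map by (intro map_idI) (auto simp: f_inv_into_f)
  ultimately have "ys \<in> rel A r \<longleftrightarrow> xs \<in> rel M r"
    using assms r unfolding embedding_def by blast
  then show "xs \<in> rel (induced M (f ` univ A)) r \<longleftrightarrow> map (inv_into (univ A) f) xs \<in> rel A r"
    using xs by (simp add: ys_def)
qed

lemma induced_finite_models:
  assumes "is_model L M" "finite X"
  shows "induced M X \<in> finite_models L"
  using assms by (auto simp: finite_models_def is_model_def)

lemma embedding_induced_id:
  "X \<subseteq> univ M \<Longrightarrow> embedding L (induced M X) M id"
  by (auto simp: embedding_def)

lemma induced_in_age:
  fixes M :: "nat rel_model"
  assumes "is_model L M" "finite X" "X \<subseteq> univ M"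
  shows "induced M X \<in> age L M"
  using assms induced_finite_models embedding_induced_id
  unfolding age_def embeddable_def by blast

text \<open>A finite model is determined by two finite sets over countable types: its universe and
  the set of all pairs of a symbol and a tuple in its relation. The second set is finite because the
  signature is finite and symbols outside it are interpreted by the empty set.\<close>

lemma countable_finite_models:
  assumes "finite (symbols L)"
  shows "countable (finite_models L :: 'a::countable rel_model set)"
proof -
  let ?g = "\<lambda>A :: 'a rel_model. (univ A, {(r, xs). xs \<in> rel A r})"
  have "inj_on ?g (finite_models L)"
  proof (rule inj_onI)
    fix A B :: "'a rel_model"
    assume "?g A = ?g B"
    then have "univ A = univ B" "rel A = rel B"
      by (auto simp: set_eq_iff)
    then show "A = B" by simp
  qed
  moreover have "?g ` finite_models L \<subseteq> Collect finite \<times> Collect finite"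
  proof clarsimp
    fix A :: "'a rel_model" assume A: "A \<in> finite_models L"
    have "{(r, xs). xs \<in> rel A r} \<subseteq>
        (SIGMA r:symbols L. {xs. set xs \<subseteq> univ A \<and> length xs = arity L r})"
      using A by (auto simp: finite_models_def is_model_def)
    moreover have "finite \<dots>"
      using A assms by (auto simp: finite_models_def intro!: finite_SigmaI finite_lists_length_eq)
    ultimately show "finite (univ A) \<and> finite {(r, xs). xs \<in> rel A r}"
      using A by (auto simp: finite_models_def intro: finite_subset)
  qed
  moreover have "countable (Collect finite \<times> Collect finite :: ('a set \<times> (nat \<times> 'a list) set) set)"
    by (intro countable_SIGMA countable_Collect_finite)
  ultimately show ?thesis
    by (meson countable_image_inj_on countable_subset)
qed

text \<open>An amalgam of two extensions of \<open>A\<close> is found inside the homogeneous structure, after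
  an automorphism has moved one copy of \<open>A\<close> onto the other.\<close>

lemma fraisse_class_age:
  fixes M :: "nat rel_model"
  assumes "is_model L M" "homogeneous L M" "finite (symbols L)"
  shows "fraisse_class L (age L M)"
  unfolding fraisse_class_def
proof (intro conjI)
  show "age L M \<subseteq> finite_models L" by (auto simp: age_def)
  show "hereditary L (age L M)"
    unfolding hereditary_def age_def embeddable_def using embedding_comp by blast
  \<comment> \<open>The set of classes is a union of singletons indexed by the age, so countability
    of the age itself is enough.\<close>
  have "countable (age L M)"
    by (rule countable_subset[OF _ countable_finite_models[OF assms(3)]]) (auto simp: age_def)
  then show "countably_many_isomorphism_types L (age L M)"
    unfolding countably_many_isomorphism_types_def quotient_def by (rule countable_UN) simp
  have fin: "finite (univ A)" if "A \<in> age L M" for A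
    using that by (auto simp: age_def finite_models_def)
  show "joint_embedding_property L (age L M)"
    unfolding joint_embedding_property_def
  proof (intro ballI)
    fix A B assume AB: "A \<in> age L M" "B \<in> age L M"
    then obtain f g where fg: "embedding L A M f" "embedding L B M g"
      by (auto simp: age_def embeddable_def)
    \<comment> \<open>The joint extension is the substructure of \<open>M\<close> spanned by the two
      images.\<close>
    let ?X = "f ` univ A \<union> g ` univ B"
    have "?X \<subseteq> univ M" using fg by (simp add: embedding_image)
    moreover have "finite ?X" using AB fin by simp
    ultimately have "induced M ?X \<in> age L M" using induced_in_age[OF assms(1)] by simp
    moreover have "embedding L A (induced M ?X) f" "embedding L B (induced M ?X) g"
      using fg by (simp_all add: embedding_induced)
    ultimately show "\<exists>C\<in>age L M. embeddable L A C \<and> embeddable L B C"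
      unfolding embeddable_def by (intro bexI[of _ "induced M ?X"] conjI exI)
  qed
  show "amalgamation_property L (age L M)"
    unfolding amalgamation_property_def
  proof (intro ballI allI impI)
    fix A B C f g
    assume ABC: "A \<in> age L M" "B \<in> age L M" "C \<in> age L M"
      and fg: "embedding L A B f \<and> embedding L A C g"
    then obtain h k where hk: "embedding L B M h" "embedding L C M k"
      by (auto simp: age_def embeddable_def)
    have hf: "embedding L A M (h \<circ> f)" and kg: "embedding L A M (k \<circ> g)"
      using fg hk embedding_comp by blast+
    let ?X = "(h \<circ> f) ` univ A" and ?Y = "(k \<circ> g) ` univ A"
    \<comment> \<open>\<open>?X\<close> and \<open>?Y\<close> are the copies of \<open>A\<close>
      that reach \<open>M\<close> through \<open>B\<close> and through \<open>C\<close>;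
      \<open>?e\<close> matches them point by point. Homogeneity extends it to \<open>u\<close>,
      after which \<open>u \<circ> h\<close> and \<open>k\<close> agree on \<open>A\<close>.\<close>
    let ?e = "(k \<circ> g) \<circ> inv_into (univ A) (h \<circ> f)"
    have sub: "?X \<subseteq> univ M" "?Y \<subseteq> univ M"
      using embedding_image[OF hf] embedding_image[OF kg] .
    have X: "inv_into (univ A) (h \<circ> f) ` ?X = univ A"
      using embedding_inj_on[OF hf] by (rule inv_into_image_cancel) simp
    have "embedding L (induced M ?X) (induced M ?Y) ?e"
      by (rule embedding_comp[OF embedding_inv[OF hf] embedding_induced[OF kg]]) simp
    moreover have "?e ` ?X = ?Y"
      using X by (metis image_comp)
    ultimately have "isomorphism L (induced M ?X) (induced M ?Y) ?e"
      by (simp add: isomorphism_def)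
    moreover have "finite ?X" "finite ?Y" using fin[OF ABC(1)] by simp_all
    ultimately have "\<exists>u. isomorphism L M M u \<and> (\<forall>x\<in>?X. u x = ?e x)"
      using sub assms(2)[unfolded homogeneous_def, rule_format, of ?X ?Y ?e] by simp
    then obtain u where u: "isomorphism L M M u" "\<And>x. x \<in> ?X \<Longrightarrow> u x = ?e x"
      by blast
    have uh: "embedding L B M (u \<circ> h)"
      using hk(1) u(1) unfolding isomorphism_def by (blast intro: embedding_comp)
    let ?Z = "(u \<circ> h) ` univ B \<union> k ` univ C"
    have "?Z \<subseteq> univ M" using embedding_image[OF uh] embedding_image[OF hk(2)] by simp
    moreover have "finite ?Z" using ABC fin by simp
    ultimately have "induced M ?Z \<in> age L M" using induced_in_age[OF assms(1)] by simp
    moreover have "embedding L B (induced M ?Z) (u \<circ> h)" "embedding L C (induced M ?Z) k"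
      using uh hk by (simp_all add: embedding_induced)
    moreover have "(u \<circ> h) (f x) = k (g x)" if "x \<in> univ A" for x
    proof -
      have "inv_into (univ A) (h \<circ> f) ((h \<circ> f) x) = x"
        using embedding_inj_on[OF hf] that by (rule inv_into_f_f)
      then show ?thesis using u(2)[of "(h \<circ> f) x"] that by simp
    qed
    ultimately show "\<exists>D\<in>age L M. \<exists>f' g'. embedding L B D f' \<and> embedding L C D g' \<and>
        (\<forall>x\<in>univ A. f' (f x) = g' (g x))"
      by (intro bexI[of _ "induced M ?Z"] exI[of _ "u \<circ> h"] exI[of _ k] conjI ballI)
  qed
qed

section \<open>Mixed digraphs\<close>

definition digraph_sig :: signature where
  "digraph_sig = \<lparr>symbols = {0}, arity = (\<lambda>_. 2)\<rparr>"

definition edge :: "'a rel_model \<Rightarrow> 'a \<Rightarrow> 'a \<Rightarrow> bool" where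
  "edge A x y \<longleftrightarrow> [x, y] \<in> rel A 0"

definition digraph :: "'a set \<Rightarrow> ('a \<Rightarrow> 'a \<Rightarrow> bool) \<Rightarrow> 'a rel_model" where
  "digraph V E = \<lparr>univ = V,
     rel = (\<lambda>r. if r = 0 then {[x, y] | x y. x \<in> V \<and> y \<in> V \<and> E x y} else {})\<rparr>"

text \<open>A single binary relation encodes a set \<open>P\<close> (the vertices without a loop), a linearly ordered
  set \<open>Q\<close> (the vertices with a loop, ordered by \<open>edge\<close>) and an arbitrary relation between \<open>P\<close>
  and \<open>Q\<close> (the edges that leave \<open>P\<close>).\<close>

definition mixed :: "'a rel_model \<Rightarrow> bool" where
  "mixed A \<longleftrightarrow>
     (\<forall>x\<in>univ A. \<forall>y\<in>univ A. edge A x y \<longrightarrow> edge A y y) \<and>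
     (\<forall>x\<in>univ A. \<forall>y\<in>univ A. edge A x x \<and> edge A y y \<longrightarrow> edge A x y \<or> edge A y x) \<and>
     (\<forall>x\<in>univ A. \<forall>y\<in>univ A. edge A x y \<and> edge A y x \<longrightarrow> x = y) \<and>
     (\<forall>x\<in>univ A. \<forall>y\<in>univ A. \<forall>z\<in>univ A.
        edge A x x \<and> edge A x y \<and> edge A y z \<longrightarrow> edge A x z)"

lemma mixedI:
  assumes "\<And>x y. x \<in> univ A \<Longrightarrow> y \<in> univ A \<Longrightarrow> edge A x y \<Longrightarrow> edge A y y"
    and "\<And>x y. x \<in> univ A \<Longrightarrow> y \<in> univ A \<Longrightarrow> edge A x x \<Longrightarrow> edge A y y \<Longrightarrow>
      edge A x y \<or> edge A y x"
    and "\<And>x y. x \<in> univ A \<Longrightarrow> y \<in> univ A \<Longrightarrow> edge A x y \<Longrightarrow> edge A y x \<Longrightarrow> x = y"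
    and "\<And>x y z. x \<in> univ A \<Longrightarrow> y \<in> univ A \<Longrightarrow> z \<in> univ A \<Longrightarrow>
      edge A x x \<Longrightarrow> edge A x y \<Longrightarrow> edge A y z \<Longrightarrow> edge A x z"
  shows "mixed A"
  unfolding mixed_def
proof (intro conjI ballI impI)
  show "edge A y y" if "x \<in> univ A" "y \<in> univ A" "edge A x y" for x y
    using that by (rule assms(1))
  show "edge A x y \<or> edge A y x"
    if "x \<in> univ A" "y \<in> univ A" "edge A x x \<and> edge A y y" for x y
    using that assms(2) by simp
  show "x = y" if "x \<in> univ A" "y \<in> univ A" "edge A x y \<and> edge A y x" for x y
    using that assms(3) by simp
  show "edge A x z" if "x \<in> univ A" "y \<in> univ A" "z \<in> univ A"
    "edge A x x \<and> edge A x y \<and> edge A y z" for x y z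
    using that by (elim conjE) (rule assms(4))
qed

lemma
  assumes "mixed A" "x \<in> univ A" "y \<in> univ A"
  shows mixed_loop: "edge A x y \<Longrightarrow> edge A y y"
    and mixed_total: "edge A x x \<Longrightarrow> edge A y y \<Longrightarrow> edge A x y \<or> edge A y x"
    and mixed_antisym: "edge A x y \<Longrightarrow> edge A y x \<Longrightarrow> x = y"
    and mixed_trans: "z \<in> univ A \<Longrightarrow> edge A x x \<Longrightarrow> edge A x y \<Longrightarrow> edge A y z \<Longrightarrow> edge A x z"
proof -
  note * = assms(1)[unfolded mixed_def]
  show "edge A x y \<Longrightarrow> edge A y y"
    using assms(2,3) *[THEN conjunct1] by simp
  show "edge A x x \<Longrightarrow> edge A y y \<Longrightarrow> edge A x y \<or> edge A y x"
    using assms(2,3) *[THEN conjunct2, THEN conjunct1] by simp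
  show "edge A x y \<Longrightarrow> edge A y x \<Longrightarrow> x = y"
    using assms(2,3) *[THEN conjunct2, THEN conjunct2, THEN conjunct1] by simp
  show "edge A x z" if "z \<in> univ A" "edge A x x" "edge A x y" "edge A y z"
    using assms(2,3) that *[THEN conjunct2, THEN conjunct2, THEN conjunct2] by blast
qed

lemma digraph_simps [simp]:
  "univ (digraph V E) = V" "edge (digraph V E) x y \<longleftrightarrow> x \<in> V \<and> y \<in> V \<and> E x y"
  by (auto simp: digraph_def edge_def)

lemma is_model_digraph: "is_model digraph_sig (digraph V E)"
  by (auto simp: is_model_def digraph_sig_def digraph_def)

lemma edge_induced [simp]: "edge (induced A X) x y \<longleftrightarrow> x \<in> X \<and> y \<in> X \<and> edge A x y"
  by (auto simp: edge_def)

lemma all_pairs_iff: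
  "(\<forall>xs. length xs = 2 \<and> set xs \<subseteq> U \<longrightarrow> P xs) \<longleftrightarrow> (\<forall>x\<in>U. \<forall>y\<in>U. P [x, y])"
proof (intro iffI allI impI ballI)
  fix xs assume P: "\<forall>x\<in>U. \<forall>y\<in>U. P [x, y]" and xs: "length xs = 2 \<and> set xs \<subseteq> U"
  then obtain x y where "xs = [x, y]"
    by (auto simp: numeral_2_eq_2 length_Suc_conv)
  with P xs show "P xs" by simp
qed simp

lemma embedding_digraph_iff:
  "embedding digraph_sig A B f \<longleftrightarrow>
     f ` univ A \<subseteq> univ B \<and> inj_on f (univ A) \<and>
     (\<forall>x\<in>univ A. \<forall>y\<in>univ A. edge A x y \<longleftrightarrow> edge B (f x) (f y))"
  by (simp add: embedding_def digraph_sig_def edge_def all_pairs_iff)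

text \<open>The axioms of \<open>mixed\<close> are universal, so they pass to substructures.\<close>

lemma mixed_embedding:
  assumes "embedding digraph_sig A B f" "mixed B"
  shows "mixed A"
proof -
  have im: "f x \<in> univ B" if "x \<in> univ A" for x
    using embedding_image[OF assms(1)] that by blast
  have inj: "x = y" if "f x = f y" "x \<in> univ A" "y \<in> univ A" for x y
    using embedding_inj_on[OF assms(1)] that by (rule inj_onD)
  have e: "edge A x y \<longleftrightarrow> edge B (f x) (f y)" if "x \<in> univ A" "y \<in> univ A" for x y
    using assms that by (simp add: embedding_digraph_iff)
  show ?thesis
  proof (rule mixedI)
    fix x y assume "x \<in> univ A" "y \<in> univ A" "edge A x y"
    then show "edge A y y" using mixed_loop[OF assms(2) im im] e by simp
  next
    fix x y assume "x \<in> univ A" "y \<in> univ A" "edge A x x" "edge A y y"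
    then show "edge A x y \<or> edge A y x" using mixed_total[OF assms(2) im im] e by simp
  next
    fix x y assume "x \<in> univ A" "y \<in> univ A" "edge A x y" "edge A y x"
    then show "x = y" using mixed_antisym[OF assms(2) im im] e inj by simp
  next
    fix x y z assume "x \<in> univ A" "y \<in> univ A" "z \<in> univ A" "edge A x x" "edge A x y" "edge A y z"
    then show "edge A x z" using mixed_trans[OF assms(2) im im im, of x y z] e by simp
  qed
qed

text \<open>Each axiom speaks of at most three points. The lemma lets \<open>mixed\<close> be read
  off from the age, which is how an arbitrary Fraisse limit is known.\<close>

lemma mixed_if_mixed_induced:
  assumes "\<And>X. X \<subseteq> univ M \<Longrightarrow> finite X \<Longrightarrow> mixed (induced M X)"
  shows "mixed M"
proof -
  have *: "mixed (induced M {x, y, z})" if "x \<in> univ M" "y \<in> univ M" "z \<in> univ M" for x y z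
    using assms that by simp
  show ?thesis
  proof (rule mixedI)
    fix x y assume "x \<in> univ M" "y \<in> univ M" "edge M x y"
    then show "edge M y y" using mixed_loop[OF *[of x y y], of x y] by simp
  next
    fix x y assume "x \<in> univ M" "y \<in> univ M" "edge M x x" "edge M y y"
    then show "edge M x y \<or> edge M y x" using mixed_total[OF *[of x y y], of x y] by simp
  next
    fix x y assume "x \<in> univ M" "y \<in> univ M" "edge M x y" "edge M y x"
    then show "x = y" using mixed_antisym[OF *[of x y y], of x y] by simp
  next
    fix x y z assume "x \<in> univ M" "y \<in> univ M" "z \<in> univ M" "edge M x x" "edge M x y" "edge M y z"
    then show "edge M x z" using mixed_trans[OF *[of x y z], of x y z] by simp
  qed
qed

section \<open>The extension property\<close>

text \<open>A set of pairs rather than a function: chains have unions, and passing to the converse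
  exchanges the two directions of back-and-forth.\<close>

definition partial_iso :: "'a rel_model \<Rightarrow> 'b rel_model \<Rightarrow> ('a \<times> 'b) set \<Rightarrow> bool" where
  "partial_iso A B p \<longleftrightarrow> p \<subseteq> univ A \<times> univ B \<and>
     (\<forall>a b c d. (a, b) \<in> p \<and> (c, d) \<in> p \<longrightarrow>
        (a = c \<longleftrightarrow> b = d) \<and> (edge A a c \<longleftrightarrow> edge B b d))"

text \<open>This is the forth half of back-and-forth. With a finite \<open>A\<close> it gives
  embeddability into \<open>M\<close>; with \<open>A = M\<close> the back half follows by
  symmetry.\<close>

definition extension_property :: "'a rel_model \<Rightarrow> 'b rel_model \<Rightarrow> bool" where
  "extension_property A M \<longleftrightarrow>
     (\<forall>p. finite p \<and> partial_iso A M p \<longrightarrow>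
        (\<forall>x\<in>univ A. \<exists>y. partial_iso A M (insert (x, y) p)))"

lemma partial_iso_converse:
  assumes "partial_iso A B p"
  shows "partial_iso B A (p\<inverse>)"
  using assms unfolding partial_iso_def by (simp add: subset_iff)

lemma partial_iso_insert:
  assumes p: "partial_iso A B p" and "x \<in> univ A" "y \<in> univ B"
    and xy: "edge A x x \<longleftrightarrow> edge B y y"
    and *: "\<And>a b. (a, b) \<in> p \<Longrightarrow> a = x \<longleftrightarrow> b = y"
      "\<And>a b. (a, b) \<in> p \<Longrightarrow> edge A a x \<longleftrightarrow> edge B b y"
      "\<And>a b. (a, b) \<in> p \<Longrightarrow> edge A x a \<longleftrightarrow> edge B y b"
  shows "partial_iso A B (insert (x, y) p)"
  unfolding partial_iso_def
proof (intro conjI allI impI)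
  show "insert (x, y) p \<subseteq> univ A \<times> univ B" using assms(1-3) by (simp add: partial_iso_def)
  fix a b c d assume "(a, b) \<in> insert (x, y) p \<and> (c, d) \<in> insert (x, y) p"
  then consider "a = x" "b = y" "c = x" "d = y" | "a = x" "b = y" "(c, d) \<in> p"
    | "(a, b) \<in> p" "c = x" "d = y" | "(a, b) \<in> p" "(c, d) \<in> p"
    by auto
  then have "(a = c \<longleftrightarrow> b = d) \<and> (edge A a c \<longleftrightarrow> edge B b d)"
  proof cases
    case 1 then show ?thesis using xy by simp
  next
    case 2 then show ?thesis using *[of c d] by auto
  next
    case 3 then show ?thesis using *[of a b] by auto
  next
    case 4 then show ?thesis using p unfolding partial_iso_def by simp
  qed
  then show "a = c \<longleftrightarrow> b = d" "edge A a c \<longleftrightarrow> edge B b d" by simp_all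
qed

lemma partial_iso_graph:
  "partial_iso A B {(x, f x) | x. x \<in> univ A} \<longleftrightarrow> embedding digraph_sig A B f"
proof -
  have "partial_iso A B {(x, f x) | x. x \<in> univ A} \<longleftrightarrow>
      (\<forall>x\<in>univ A. f x \<in> univ B) \<and>
      (\<forall>x\<in>univ A. \<forall>y\<in>univ A. (x = y \<longleftrightarrow> f x = f y) \<and> (edge A x y \<longleftrightarrow> edge B (f x) (f y)))"
    unfolding partial_iso_def by (simp add: subset_iff) blast
  then show ?thesis
    unfolding embedding_digraph_iff inj_on_def image_subset_iff by blast
qed

lemma partial_iso_total:
  assumes "partial_iso A B p" "Domain p = univ A"
  obtains f where "embedding digraph_sig A B f" "p = {(x, f x) | x. x \<in> univ A}"
proof -
  have "\<forall>x\<in>univ A. \<exists>y. (x, y) \<in> p" using assms(2) by blast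
  then obtain f where f: "\<And>x. x \<in> univ A \<Longrightarrow> (x, f x) \<in> p" by metis
  have "b = f a" if "(a, b) \<in> p" for a b
    using f assms that unfolding partial_iso_def by (metis DomainI)
  then have "p = {(x, f x) | x. x \<in> univ A}"
    using f assms(2) by auto
  then show ?thesis
    using that[of f] assms(1) partial_iso_graph[of A B f] by simp
qed

text \<open>The points of \<open>A\<close> are added one at a time, starting from the empty partial
  isomorphism.\<close>

lemma extension_property_embeddable:
  assumes "extension_property A M" "finite (univ A)"
  shows "embeddable digraph_sig A M"
proof -
  have "\<exists>p. finite p \<and> partial_iso A M p \<and> Domain p = X" if "finite X" "X \<subseteq> univ A" for X
    using that
  proof (induction X)
    case empty
    then show ?case by (intro exI[of _ "{}"]) (auto simp: partial_iso_def)
  next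
    case (insert x X)
    then obtain p where "finite p" "partial_iso A M p" "Domain p = X" by auto
    moreover from this obtain y where "partial_iso A M (insert (x, y) p)"
      using assms(1) insert.prems unfolding extension_property_def by blast
    ultimately show ?case by (intro exI[of _ "insert (x, y) p"]) auto
  qed
  from this[OF assms(2)] show ?thesis
    unfolding embeddable_def by (metis order_refl partial_iso_total)
qed

lemma partial_iso_induced:
  assumes "partial_iso (induced A X) (induced B Y) p" "X \<subseteq> univ A" "Y \<subseteq> univ B"
  shows "partial_iso A B p"
  unfolding partial_iso_def
proof (intro conjI allI impI)
  have p: "p \<subseteq> X \<times> Y" using assms(1) by (simp add: partial_iso_def)
  then show "p \<subseteq> univ A \<times> univ B" using assms(2,3) by blast
  fix a b c d assume ac: "(a, b) \<in> p \<and> (c, d) \<in> p"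
  then have "a \<in> X" "b \<in> Y" "c \<in> X" "d \<in> Y" using p by auto
  moreover have "(a = c \<longleftrightarrow> b = d) \<and> (edge (induced A X) a c \<longleftrightarrow> edge (induced B Y) b d)"
    using assms(1) ac unfolding partial_iso_def by blast
  ultimately show "a = c \<longleftrightarrow> b = d" "edge A a c \<longleftrightarrow> edge B b d" by simp_all
qed

text \<open>Back-and-forth: the graph of the given finite isomorphism grows along an enumeration of
  \<open>M\<close> until its domain and range are everything.\<close>

lemma extension_property_homogeneous:
  assumes "extension_property M M" "countable (univ M)"
  shows "homogeneous digraph_sig M"
  unfolding homogeneous_def
proof (intro allI impI)
  fix X Y f
  assume *: "X \<subseteq> univ M \<and> finite X \<and> Y \<subseteq> univ M \<and> finite Y \<and>
    isomorphism digraph_sig (induced M X) (induced M Y) f"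
  \<comment> \<open>For an empty universe the values of \<open>e\<close> are unspecified, hence the
    guard \<open>e n \<in> univ M\<close> below.\<close>
  define e where "e = from_nat_into (univ M)"
  let ?good = "\<lambda>p. finite p \<and> partial_iso M M p"
  have forth_step: "\<exists>q. p \<subseteq> q \<and> ?good q \<and> x \<in> Domain q" if p: "?good p" "x \<in> univ M" for p x
  proof -
    obtain y where "partial_iso M M (insert (x, y) p)"
      using assms(1) p unfolding extension_property_def by blast
    then show ?thesis using p(1) by (intro exI[of _ "insert (x, y) p"]) auto
  qed
  \<comment> \<open>This is the forth step applied to the converse relation.\<close>
  have back_step: "\<exists>q. p \<subseteq> q \<and> ?good q \<and> y \<in> Range q" if p: "?good p" "y \<in> univ M" for p y
  proof -
    obtain q where "p\<inverse> \<subseteq> q" "?good q" "y \<in> Domain q"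
      using forth_step[of "p\<inverse>" y] p by (auto intro: partial_iso_converse)
    then show ?thesis
      by (intro exI[of _ "q\<inverse>"]) (auto intro: partial_iso_converse)
  qed
  define p0 where "p0 = {(x, f x) | x. x \<in> X}"
  have p0: "?good p0"
  proof
    show "finite p0" using * by (simp add: p0_def Setcompr_eq_image)
    have "partial_iso (induced M X) (induced M Y) p0"
      unfolding p0_def using * partial_iso_graph[of "induced M X" "induced M Y" f] by (simp add: isomorphism_def)
    then show "partial_iso M M p0" using * by (simp add: partial_iso_induced)
  qed
  have "\<exists>p. \<forall>n. (?good (p n) \<and> p0 \<subseteq> p n) \<and>
    (p n \<subseteq> p (Suc n) \<and> (e n \<in> univ M \<longrightarrow> e n \<in> Domain (p (Suc n)) \<and> e n \<in> Range (p (Suc n))))"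
  proof (rule dependent_nat_choice)
    show "\<exists>p. ?good p \<and> p0 \<subseteq> p" using p0 by (intro exI[of _ p0]) simp
  next
    fix p n assume p: "?good p \<and> p0 \<subseteq> p"
    show "\<exists>q. (?good q \<and> p0 \<subseteq> q) \<and>
      (p \<subseteq> q \<and> (e n \<in> univ M \<longrightarrow> e n \<in> Domain q \<and> e n \<in> Range q))"
    proof (cases "e n \<in> univ M")
      case True
      obtain q where q: "p \<subseteq> q" "?good q" "e n \<in> Domain q"
        using forth_step[of p "e n"] p True by auto
      obtain q' where q': "q \<subseteq> q'" "?good q'" "e n \<in> Range q'"
        using back_step[of q "e n"] q True by auto
      have "e n \<in> Domain q'" using q(3) q'(1) by blast
      moreover have "p \<subseteq> q'" using q(1) q'(1) by (rule subset_trans)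
      moreover have "p0 \<subseteq> q'" using p \<open>p \<subseteq> q'\<close> by auto
      ultimately show ?thesis using q' by (intro exI[of _ q']) simp
    next
      case False
      then show ?thesis using p by (intro exI[of _ p]) simp
    qed
  qed
  then obtain p where p: "\<And>n. ?good (p n)" "\<And>n. p0 \<subseteq> p n" "\<And>n. p n \<subseteq> p (Suc n)"
    "\<And>n. e n \<in> univ M \<Longrightarrow> e n \<in> Domain (p (Suc n)) \<and> e n \<in> Range (p (Suc n))"
    by metis
  \<comment> \<open>Any two pairs of the union already lie in a common stage of the increasing
    chain, so the conditions on partial isomorphisms survive in the limit.\<close>
  define q where "q = (\<Union>n. p n)"
  have mono: "m \<le> n \<Longrightarrow> p m \<subseteq> p n" for m n using p(3) by (rule lift_Suc_mono_le)
  have "partial_iso M M q"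
    unfolding partial_iso_def
  proof (intro conjI)
    show "q \<subseteq> univ M \<times> univ M"
      unfolding q_def using p(1) by (intro UN_least) (simp add: partial_iso_def)
    show "\<forall>a b c d. (a, b) \<in> q \<and> (c, d) \<in> q \<longrightarrow>
        (a = c \<longleftrightarrow> b = d) \<and> (edge M a c \<longleftrightarrow> edge M b d)"
    proof (intro allI impI)
      fix a b c d assume "(a, b) \<in> q \<and> (c, d) \<in> q"
      then obtain m n where "(a, b) \<in> p m" "(c, d) \<in> p n" by (auto simp: q_def)
      then have "(a, b) \<in> p (max m n)" "(c, d) \<in> p (max m n)"
        using mono[of m "max m n"] mono[of n "max m n"] by auto
      then show "(a = c \<longleftrightarrow> b = d) \<and> (edge M a c \<longleftrightarrow> edge M b d)"
        using p(1)[of "max m n", THEN conjunct2] unfolding partial_iso_def by simp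
    qed
  qed
  moreover have "x \<in> Domain q \<and> x \<in> Range q" if x: "x \<in> univ M" for x
  proof -
    obtain n where "e n = x"
      using from_nat_into_surj[OF assms(2) x] by (auto simp: e_def)
    then have "x \<in> Domain (p (Suc n))" "x \<in> Range (p (Suc n))" using p(4)[of n] x by simp_all
    then show ?thesis unfolding q_def by blast
  qed
  ultimately have q: "partial_iso M M q" "Domain q = univ M" "Range q = univ M"
    by (auto simp: partial_iso_def)
  from partial_iso_total[OF q(1,2)]
  obtain g where g: "embedding digraph_sig M M g" "q = {(x, g x) | x. x \<in> univ M}" .
  have "g ` univ M = univ M"
    using q(3) unfolding g(2) by auto
  then have "isomorphism digraph_sig M M g"
    using g(1) by (simp add: isomorphism_def)
  moreover have "g x = f x" if "x \<in> X" for x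
  proof -
    have "(x, f x) \<in> p0" using that by (simp add: p0_def)
    then have "(x, f x) \<in> q" using p(2) unfolding q_def by blast
    then show ?thesis using g(2) by auto
  qed
  ultimately show "\<exists>g. isomorphism digraph_sig M M g \<and> (\<forall>x\<in>X. g x = f x)"
    by (intro exI[of _ g]) simp
qed

section \<open>The limit\<close>

text \<open>For an irrational \<open>t\<close> the translates of the rationals by the multiples
  \<open>s * t\<close> are pairwise disjoint and dense. The colour of a point is decoded from the
  index \<open>s\<close> of its translate, so every colour class is dense.\<close>

lemma dense_coloring:
  obtains v :: "nat \<Rightarrow> real" and c :: "nat \<Rightarrow> 'c::countable"
  where "inj v" "\<And>a b k. a < b \<Longrightarrow> \<exists>n. a < v n \<and> v n < b \<and> c n = k"
proof -
  obtain t :: real where t: "t \<notin> \<rat>"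
    using countable_rat uncountable_UNIV_real by (metis UNIV_eq_I)
  define pos where "pos = (\<lambda>(r, s). of_rat r + real s * t :: real)"
  have "inj pos"
  proof (rule injI)
    fix x y assume *: "pos x = pos y"
    obtain r s r' s' where xy: "x = (r, s)" "y = (r', s')" by (metis surj_pair)
    have eq: "of_rat (r' - r) = (real s - real s') * t"
      using * by (simp add: xy pos_def of_rat_diff algebra_simps)
    \<comment> \<open>Otherwise the equation could be solved for \<open>t\<close>, making it
      rational.\<close>
    have "s = s'"
    proof (rule ccontr)
      assume "s \<noteq> s'"
      then have "t = of_rat (r' - r) / (real s - real s')" using eq by simp
      also have "\<dots> \<in> \<rat>" by (intro Rats_divide Rats_diff Rats_of_nat Rats_of_rat)
      finally show False using t by simp
    qed
    then show "x = y" using eq by (simp add: xy)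
  qed
  define e where "e = from_nat_into (UNIV :: (rat \<times> nat) set)"
  have "infinite (UNIV :: (rat \<times> nat) set)"
    by (simp add: finite_prod)
  then have e: "bij e"
    unfolding e_def by (intro bij_betw_from_nat_into) auto
  define c :: "nat \<Rightarrow> 'c" where "c = from_nat \<circ> snd \<circ> e"
  show ?thesis
  proof
    show "inj (pos \<circ> e)" using \<open>inj pos\<close> e by (simp add: bij_is_inj inj_compose)
    fix a b :: real and k :: 'c assume "a < b"
    define s where "s = to_nat k"
    obtain r where r: "a - real s * t < of_rat r" "of_rat r < b - real s * t"
      using of_rat_dense[of "a - real s * t" "b - real s * t"] \<open>a < b\<close> by auto
    obtain n where n: "e n = (r, s)" using e by (metis bij_pointE)
    have "a < (pos \<circ> e) n \<and> (pos \<circ> e) n < b \<and> c n = k"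
      using n r by (simp add: pos_def c_def s_def)
    then show "\<exists>n. a < (pos \<circ> e) n \<and> (pos \<circ> e) n < b \<and> c n = k" by blast
  qed
qed

text \<open>This opens the gap in which a new point of the linear order is placed.
  \<open>Max\<close> and \<open>Min\<close> say nothing about empty sets, hence the four
  cases.\<close>

lemma finite_sets_separated:
  fixes L U :: "real set"
  assumes "finite L" "finite U" "\<And>l u. l \<in> L \<Longrightarrow> u \<in> U \<Longrightarrow> l < u"
  obtains a b where "a < b" "\<And>l. l \<in> L \<Longrightarrow> l \<le> a" "\<And>u. u \<in> U \<Longrightarrow> b \<le> u"
proof -
  consider "L = {}" "U = {}" | "L \<noteq> {}" "U = {}" | "L = {}" "U \<noteq> {}" | "L \<noteq> {}" "U \<noteq> {}"
    by blast
  then show ?thesis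
  proof cases
    case 1 then show ?thesis using that[of 0 1] by simp
  next
    case 2 then show ?thesis using that[of "Max L" "Max L + 1"] assms by simp
  next
    case 3 then show ?thesis using that[of "Min U - 1" "Min U"] assms by (simp del: Min_gr_iff)
  next
    case 4 then show ?thesis using that[of "Max L" "Min U"] assms by simp
  qed
qed

text \<open>The vertex \<open>n\<close> has a position \<open>v n\<close> on the real line and a finite set \<open>F n\<close> of vertices; as
  in the random graph, an element of \<open>P\<close> and one of \<open>Q\<close> are joined if one belongs to
  the set of the other. The third
  component of the colour serves only to provide infinitely many vertices for each set.\<close>

lemma mixed_limit_exists:
  obtains M :: "nat rel_model"
  where "is_model digraph_sig M" "mixed M"
    "\<And>A :: 'a rel_model. mixed A \<Longrightarrow> extension_property A M"
proof -
  obtain v :: "nat \<Rightarrow> real" and c :: "nat \<Rightarrow> bool \<times> nat list \<times> nat"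
    where v: "inj v" and c: "\<And>a b k. a < b \<Longrightarrow> \<exists>n. a < v n \<and> v n < b \<and> c n = k"
    using dense_coloring by blast
  define Q where "Q n = fst (c n)" for n
  define F where "F n = set (fst (snd (c n)))" for n
  \<comment> \<open>The disjunction allows a new vertex of either kind to prescribe its neighbours
    among the old vertices by its own set.\<close>
  define E where "E x y \<longleftrightarrow> Q y \<and> (if Q x then v x \<le> v y else x \<in> F y \<or> y \<in> F x)" for x y
  \<comment> \<open>A third colour component occurring at no vertex of \<open>Z\<close> keeps the
    new vertex out of \<open>Z\<close>.\<close>
  have generic: "\<exists>n. a < v n \<and> v n < b \<and> Q n = q \<and> F n = S \<and> n \<notin> Z"
    if "a < b" "finite S" "finite Z" for a b q S Z
  proof -
    obtain xs where xs: "set xs = S" using finite_list[OF \<open>finite S\<close>] by blast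
    obtain k where k: "k \<notin> (\<lambda>n. snd (snd (c n))) ` Z"
      using ex_new_if_finite[OF infinite_UNIV_nat] \<open>finite Z\<close> by blast
    obtain n where n: "a < v n" "v n < b" "c n = (q, xs, k)"
      using c[OF \<open>a < b\<close>, of "(q, xs, k)"] by blast
    then have "n \<notin> Z" using k by force
    then show ?thesis using n xs by (auto simp: Q_def F_def)
  qed
  define M where "M = digraph UNIV E"
  have [simp]: "univ M = UNIV" "edge M x y \<longleftrightarrow> E x y" for x y by (simp_all add: M_def)
  show ?thesis
  proof
    show "is_model digraph_sig M" by (simp add: M_def is_model_digraph)
    show "mixed M"
    proof (rule mixedI)
      show "x = y" if "edge M x y" "edge M y x" for x y
        using that injD[OF v, of x y] by (auto simp: E_def split: if_splits)
    qed (auto simp: E_def split: if_splits)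
  next
    fix A :: "'a rel_model" assume A: "mixed A"
    show "extension_property A M"
      unfolding extension_property_def
    proof (intro allI impI ballI, elim conjE)
      fix p x assume fin: "finite p" and p: "partial_iso A M p" and x: "x \<in> univ A"
      have pA: "a \<in> univ A" if "(a, b) \<in> p" for a b using p that by (auto simp: partial_iso_def)
      have eq: "a = c \<longleftrightarrow> b = d" and ed: "edge A a c \<longleftrightarrow> E b d"
        if "(a, b) \<in> p" "(c, d) \<in> p" for a b c d
        using p that unfolding partial_iso_def by simp_all
      have Q: "Q b \<longleftrightarrow> edge A a a" if "(a, b) \<in> p" for a b
        using ed[OF that that] by (simp add: E_def)
      have loop: "edge A a c \<Longrightarrow> edge A c c" if "a \<in> univ A" "c \<in> univ A" for a c
        using mixed_loop[OF A that] .
      show "\<exists>y. partial_iso A M (insert (x, y) p)"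
      proof (cases "x \<in> Domain p")
        case True
        then obtain y where "(x, y) \<in> p" by blast
        then show ?thesis using p by (intro exI[of _ y]) (simp add: insert_absorb)
      next
        case False
        have x_neq: "a \<noteq> x" if "(a, b) \<in> p" for a b using False that by blast
        \<comment> \<open>\<open>S\<close> becomes the set of the new vertex: the images of the
          prescribed neighbours of \<open>x\<close>. If \<open>x\<close> lies in the ordered part,
          \<open>S\<close> may contain images of other looped vertices; this does no harm, since
          \<open>E\<close> compares looped vertices by position only.\<close>
        define S where "S = {b \<in> Range p. \<exists>a.
          (a, b) \<in> p \<and> (if edge A x x then edge A a x else edge A x a)}"
        \<comment> \<open>Outside \<open>Z\<close>, the vertex \<open>y\<close> is new and belongs
          to no set \<open>F b\<close> of an old vertex \<open>b\<close>, so \<open>S\<close> alone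
          decides the edges between the two kinds.\<close>
        define Z where "Z = Range p \<union> (\<Union>b\<in>Range p. F b)"
        have "finite S" "finite Z"
          using fin by (auto simp: S_def Z_def F_def finite_Range)
        \<comment> \<open>If \<open>x\<close> has a loop, \<open>L\<close> and \<open>U\<close> hold
          the positions of the images of the looped points below and above \<open>x\<close>; the new
          vertex has to go between them.\<close>
        define L where "L = {v b | a b. (a, b) \<in> p \<and> edge A a a \<and> edge A a x}"
        define U where "U = {v b | a b. (a, b) \<in> p \<and> edge A a a \<and> \<not> edge A a x}"
        have LU: "L \<subseteq> v ` Range p" "U \<subseteq> v ` Range p" by (auto simp: L_def U_def)
        then have "finite L" "finite U" using fin by (auto intro: finite_subset simp: finite_Range)
        show ?thesis
        proof (cases "edge A x x")
          case xP: False
          obtain y where y: "Q y = False" "F y = S" "y \<notin> Z"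
            \<comment> \<open>Positions do not affect the edges of a loop-free vertex, so any
              interval will do.\<close>
            using generic[of 0 1 S Z False] \<open>finite S\<close> \<open>finite Z\<close> by auto
          have "a = x \<longleftrightarrow> b = y" "edge A a x \<longleftrightarrow> E b y" "edge A x a \<longleftrightarrow> E y b"
            if ab: "(a, b) \<in> p" for a b
          proof -
            show "a = x \<longleftrightarrow> b = y" using x_neq[OF ab] y(3) ab by (auto simp: Z_def)
            show "edge A a x \<longleftrightarrow> E b y" using xP loop[OF pA[OF ab] x] y(1) by (auto simp: E_def)
            have "b \<in> S \<longleftrightarrow> edge A x a"
              using ab xP eq by (auto simp: S_def)
            moreover have "y \<notin> F b" using y(3) ab by (auto simp: Z_def)
            ultimately show "edge A x a \<longleftrightarrow> E y b"
              using y Q[OF ab] loop[OF x pA[OF ab]] by (auto simp: E_def)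
          qed
          moreover have "edge A x x \<longleftrightarrow> E y y" using xP y(1) by (simp add: E_def)
          ultimately show ?thesis
            using p x by (intro exI[of _ y] partial_iso_insert) simp_all
        next
          case xQ: True
          have "l < u" if lu: "l \<in> L" "u \<in> U" for l u
          proof -
            obtain a b where ab: "l = v b" "(a, b) \<in> p" "edge A a a" "edge A a x"
              using lu(1) by (auto simp: L_def)
            obtain c d where cd: "u = v d" "(c, d) \<in> p" "edge A c c" "\<not> edge A c x"
              using lu(2) by (auto simp: U_def)
            \<comment> \<open>In the order of \<open>A\<close>, \<open>a\<close> precedes
              \<open>x\<close> and \<open>x\<close> precedes \<open>c\<close>. Hence
              \<open>v b \<le> v d\<close>, and injectivity of \<open>v\<close> makes this
              strict.\<close>
            have "edge A x c" using mixed_total[OF A pA[OF cd(2)] x cd(3) xQ] cd(4) by simp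
            then have "edge A a c" using mixed_trans[OF A pA[OF ab(2)] x pA[OF cd(2)] ab(3,4)] by simp
            then have "E b d" using ed[OF ab(2) cd(2)] by simp
            then have "v b \<le> v d" using Q[OF ab(2)] ab(3) by (simp add: E_def)
            moreover have "b \<noteq> d" using eq[OF ab(2) cd(2)] ab(4) cd(4) by auto
            ultimately show ?thesis using ab(1) cd(1) injD[OF v, of b d] by fastforce
          qed
          then obtain lo hi where lh: "lo < hi" "\<And>l. l \<in> L \<Longrightarrow> l \<le> lo" "\<And>u. u \<in> U \<Longrightarrow> hi \<le> u"
            using finite_sets_separated[OF \<open>finite L\<close> \<open>finite U\<close>] by blast
          obtain y where y: "lo < v y" "v y < hi" "Q y = True" "F y = S" "y \<notin> Z"
            using generic[OF lh(1) \<open>finite S\<close> \<open>finite Z\<close>, of True] by auto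
          have "a = x \<longleftrightarrow> b = y" "edge A a x \<longleftrightarrow> E b y" "edge A x a \<longleftrightarrow> E y b"
            if ab: "(a, b) \<in> p" for a b
          proof -
            show "a = x \<longleftrightarrow> b = y" using x_neq[OF ab] y(5) ab by (auto simp: Z_def)
            have "b \<in> S \<longleftrightarrow> edge A a x"
              using ab xQ eq by (auto simp: S_def)
            moreover have "y \<notin> F b" using y(5) ab by (auto simp: Z_def)
            moreover have "v b < v y" if "edge A a a" "edge A a x"
              using lh(2)[of "v b"] that ab y(1) by (force simp: L_def)
            moreover have hi: "v y < v b" if "edge A a a" "\<not> edge A a x"
              using lh(3)[of "v b"] that ab y(2) by (force simp: U_def)
            moreover have "\<not> edge A x a" if "edge A a x"
              using mixed_antisym[OF A pA[OF ab] x that] x_neq[OF ab] by blast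
            moreover have "edge A x a" if "edge A a a" "\<not> edge A a x"
              using mixed_total[OF A pA[OF ab] x that(1) xQ] that(2) by simp
            ultimately have *: "b \<in> F y \<or> y \<in> F b \<longleftrightarrow> edge A a x"
              "edge A a a \<Longrightarrow> edge A a x \<longleftrightarrow> v b \<le> v y"
              "edge A a a \<Longrightarrow> edge A x a \<longleftrightarrow> v y \<le> v b"
              using y(4) by (simp, force, force)
            show "edge A a x \<longleftrightarrow> E b y"
              using *(1,2) y(3) Q[OF ab] by (simp add: E_def)
            show "edge A x a \<longleftrightarrow> E y b"
              using *(3) y(3) Q[OF ab] loop[OF x pA[OF ab]] by (auto simp: E_def)
          qed
          moreover have "edge A x x \<longleftrightarrow> E y y" using xQ y(3) by (simp add: E_def)
          ultimately show ?thesis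
            using p x by (intro exI[of _ y] partial_iso_insert) simp_all
        qed
      qed
    qed
  qed
qed

section \<open>Automorphisms\<close>

lemma isomorphism_digraph_imp:
  assumes "isomorphism digraph_sig A B f" "x \<in> univ A"
  shows "f x \<in> univ B"
  using assms by (auto simp: isomorphism_def)

text \<open>Automorphisms are extensional and multiplied by \<open>compose\<close>, so a power is an
  iterate cut down to the universe; torsion thereby becomes a statement about orbits.\<close>

lemma automorphism_group_pow:
  assumes "f \<in> carrier (automorphism_group L A)"
  shows "f [^]\<^bsub>automorphism_group L A\<^esub> n = restrict (f ^^ n) (univ A)"
proof (induction n)
  case 0
  show ?case by (auto simp: automorphism_group_def BijGroup_def)
next
  case (Suc n)
  have f: "f \<in> Bij (univ A)" using assms by (simp add: automorphism_group_def)
  then have bij: "bij_betw f (univ A) (univ A)" by (simp add: Bij_def)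
  have "restrict (f ^^ n) (univ A) \<in> Bij (univ A)"
    using bij_betw_funpow[OF bij] by (simp add: Bij_def)
  moreover have "f x \<in> univ A" if "x \<in> univ A" for x
    using bij that by (rule bij_betw_apply)
  then have "compose (univ A) (restrict (f ^^ n) (univ A)) f = restrict (f ^^ Suc n) (univ A)"
    by (simp add: compose_def restrict_def fun_eq_iff funpow_swap1)
  moreover have "g \<otimes>\<^bsub>automorphism_group L A\<^esub> h = compose (univ A) g h"
    if "g \<in> Bij (univ A)" "h \<in> Bij (univ A)" for g h
    using that by (simp add: automorphism_group_def BijGroup_def)
  ultimately show ?case
    using f by (simp only: nat_pow_Suc Suc)
qed

lemma torsion_free_automorphism_group:
  assumes M: "mixed M"
    and sep: "\<And>x y. x \<in> univ M \<Longrightarrow> y \<in> univ M \<Longrightarrow> x \<noteq> y \<Longrightarrow> \<not> edge M x x \<Longrightarrow> \<not> edge M y y \<Longrightarrow>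
      \<exists>q\<in>univ M. edge M x q \<and> \<not> edge M y q"
  shows "torsion_free (automorphism_group digraph_sig M)"
  unfolding torsion_free_def
proof (intro ballI allI impI, elim conjE)
  let ?G = "automorphism_group digraph_sig M"
  fix f and n :: nat
  assume f: "f \<in> carrier ?G" and n: "n > 0" and fn: "f [^]\<^bsub>?G\<^esub> n = \<one>\<^bsub>?G\<^esub>"
  have ext: "f \<in> extensional (univ M)" and iso: "isomorphism digraph_sig M M f"
    using f by (simp_all add: automorphism_group_def Bij_def)
  have im: "f x \<in> univ M" if "x \<in> univ M" for x
    using isomorphism_digraph_imp[OF iso that] .
  have ed: "edge M (f x) (f y) \<longleftrightarrow> edge M x y" if "x \<in> univ M" "y \<in> univ M" for x y
    using iso that by (simp add: isomorphism_def embedding_digraph_iff)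
  have imn: "(f ^^ k) x \<in> univ M" if "x \<in> univ M" for k x
    by (induction k) (simp_all add: im that)
  have edn: "edge M ((f ^^ k) x) ((f ^^ k) y) \<longleftrightarrow> edge M x y"
    if "x \<in> univ M" "y \<in> univ M" for k x y
    by (induction k) (simp_all add: ed imn that)
  have "restrict (f ^^ n) (univ M) = (\<lambda>x\<in>univ M. x)"
    using fn unfolding automorphism_group_pow[OF f] by (simp add: automorphism_group_def BijGroup_def)
  then have fn: "(f ^^ n) x = x" if "x \<in> univ M" for x
    using that by (metis restrict_apply')
  \<comment> \<open>If \<open>q\<close> lies below \<open>f q\<close>, its orbit ascends, so
    \<open>f q\<close> lies below the \<open>n\<close>-th iterate, which is \<open>q\<close> again;
    antisymmetry gives equality. The case of a descending orbit is dual. Writing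
    \<open>n = Suc k\<close> makes the positivity of \<open>n\<close> usable.\<close>
  have fixQ: "f q = q" if q: "q \<in> univ M" "edge M q q" for q
  proof -
    have fq: "edge M (f q) (f q)" using ed q by simp
    have loop: "edge M ((f ^^ k) q) ((f ^^ k) q)" for k using edn[of q q k] q by simp
    have up: "edge M (f q) ((f ^^ Suc k) q)" if "edge M q (f q)" for k
    proof (induction k)
      case (Suc k)
      have "edge M ((f ^^ Suc k) q) ((f ^^ Suc k) (f q))" using that edn q im by blast
      then have "edge M ((f ^^ Suc k) q) ((f ^^ Suc (Suc k)) q)" by (simp add: funpow_swap1)
      then show ?case using mixed_trans[OF M im imn imn fq] q Suc by blast
    qed (simp add: fq)
    have down: "edge M ((f ^^ Suc k) q) (f q)" if "edge M (f q) q" for k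
    proof (induction k)
      case (Suc k)
      have "edge M ((f ^^ Suc k) (f q)) ((f ^^ Suc k) q)" using that edn q im by blast
      then have "edge M ((f ^^ Suc (Suc k)) q) ((f ^^ Suc k) q)" by (simp add: funpow_swap1)
      then show ?case using mixed_trans[OF M imn imn im loop] q Suc by blast
    qed (simp add: fq)
    obtain k where k: "n = Suc k" using n gr0_conv_Suc by blast
    from mixed_total[OF M q(1) im[OF q(1)] q(2) fq] show ?thesis
    proof
      assume *: "edge M q (f q)"
      have "edge M (f q) q" using up[OF *, of k] fn[OF q(1)] unfolding k by simp
      then show ?thesis using mixed_antisym[OF M im q(1)] q * by blast
    next
      assume *: "edge M (f q) q"
      have "edge M q (f q)" using down[OF *, of k] fn[OF q(1)] unfolding k by simp
      then show ?thesis using mixed_antisym[OF M im q(1)] q * by blast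
    qed
  qed
  have "f x = x" if x: "x \<in> univ M" for x
  proof (cases "edge M x x")
    case False
    show ?thesis
    proof (rule ccontr)
      assume "f x \<noteq> x"
      \<comment> \<open>\<open>f\<close> fixes the separating point \<open>q\<close>, so it carries
        the edge from \<open>x\<close> to \<open>q\<close> to an edge from \<open>f x\<close> to
        \<open>q\<close>.\<close>
      then obtain q where q: "q \<in> univ M" "edge M x q" "\<not> edge M (f x) q"
        using sep[of x "f x"] False x im ed by metis
      have "edge M q q" using mixed_loop[OF M x q(1,2)] .
      then have "edge M (f x) q" using ed[OF x q(1)] fixQ q by simp
      then show False using q(3) by simp
    qed
  qed (simp add: fixQ x)
  then have "f = (\<lambda>x\<in>univ M. x)"
    using ext by (auto simp: extensional_def)
  then show "f = \<one>\<^bsub>?G\<^esub>" by (simp add: automorphism_group_def BijGroup_def)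
qed

text \<open>Without edges every bijection of \<open>X\<close> is an automorphism, and conjugation
  with an enumeration of \<open>X\<close> turns bijections of \<open>X\<close> into permutations of
  the indices.\<close>

lemma automorphism_group_edgeless:
  assumes X: "finite X" "card X = n" "\<And>x y. x \<in> X \<Longrightarrow> y \<in> X \<Longrightarrow> \<not> edge M x y"
  shows "automorphism_group digraph_sig (induced M X) \<cong> sym_group n"
proof -
  let ?I = "{1..n}" and ?G = "automorphism_group digraph_sig (induced M X)"
  have iso: "isomorphism digraph_sig (induced M X) (induced M X) f" if "f \<in> Bij X" for f
    using that X(3) by (auto simp: isomorphism_def embedding_digraph_iff Bij_def bij_betw_def)
  have G: "?G = BijGroup X"
    using iso by (auto simp: automorphism_group_def BijGroup_def)
  obtain h where h: "bij_betw h ?I X"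
    using ex_bij_betw_nat_finite_1[OF X(1)] X(2) by auto
  define h' where "h' = inv_into ?I h"
  have h': "bij_betw h' X ?I" unfolding h'_def using h by (rule bij_betw_inv_into)
  have hh: "h i \<in> X" "h' (h i) = i" if "i \<in> ?I" for i
    using h that by (auto simp: h'_def bij_betw_def)
  have hh': "h' x \<in> ?I" "h (h' x) = x" if "x \<in> X" for x
    using bij_betw_apply[OF h' that] bij_betw_inv_into_right[OF h that] by (simp_all add: h'_def)
  \<comment> \<open>The two groups treat outside points differently: \<open>permutes\<close> demands
    that they be fixed, whereas members of \<open>Bij X\<close> are undefined there. Hence the
    default \<open>i\<close> here and \<open>restrict\<close> in \<open>?dn\<close>.\<close>
  let ?up = "\<lambda>f i. if i \<in> ?I then h' (f (h i)) else i"
  let ?dn = "\<lambda>p. restrict (h \<circ> p \<circ> h') X"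
  have fX: "f x \<in> X" if "f \<in> Bij X" "x \<in> X" for f x
    using that Bij_imp_funcset by blast
  have up: "?up f permutes ?I" if f: "f \<in> Bij X" for f
  proof (rule bij_imp_permutes)
    have "bij_betw (h' \<circ> (f \<circ> h)) ?I ?I"
      using f h h' by (auto simp: Bij_def intro: bij_betw_trans)
    then show "bij_betw (?up f) ?I ?I" by (rule bij_betw_cong[THEN iffD1, rotated]) simp
  qed auto
  have dn: "?dn p \<in> Bij X" if p: "p permutes ?I" for p
  proof -
    have "bij_betw (h \<circ> p \<circ> h') X X"
      using permutes_imp_bij[OF p] h h' by (auto intro: bij_betw_trans)
    then show ?thesis by (simp add: Bij_def)
  qed
  have "?up \<in> iso ?G (sym_group n)"
    unfolding iso_def G
  proof (intro CollectI conjI homI)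
    show "?up f \<in> carrier (sym_group n)" if "f \<in> carrier (BijGroup X)" for f
      using up that by (simp add: BijGroup_def sym_group_carrier)
    show "?up (f \<otimes>\<^bsub>BijGroup X\<^esub> g) = ?up f \<otimes>\<^bsub>sym_group n\<^esub> ?up g"
      if "f \<in> carrier (BijGroup X)" "g \<in> carrier (BijGroup X)" for f g
      using that hh hh' fX by (auto simp: BijGroup_def sym_group_mult compose_def fun_eq_iff)
    show "bij_betw ?up (carrier (BijGroup X)) (carrier (sym_group n))"
    proof (rule bij_betw_byWitness[where f' = ?dn])
      show "\<forall>f\<in>carrier (BijGroup X). ?dn (?up f) = f"
        using hh hh' fX by (auto simp: BijGroup_def fun_eq_iff Bij_def extensional_def)
      show "\<forall>p\<in>carrier (sym_group n). ?up (?dn p) = p"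
      proof
        fix p assume "p \<in> carrier (sym_group n)"
        then have p: "p permutes ?I" by (simp add: sym_group_carrier)
        have "?up (?dn p) i = p i" for i
        proof (cases "i \<in> ?I")
          case True
          then show ?thesis using hh[OF True] hh[of "p i"] permutes_in_image[OF p, of i] by simp
        next
          case False
          then show ?thesis using permutes_not_in[OF p False] by auto
        qed
        then show "?up (?dn p) = p" by (rule ext)
      qed
    qed (use up dn in \<open>auto simp: BijGroup_def sym_group_carrier\<close>)
  qed
  then show ?thesis by (auto simp: is_iso_def)
qed

text \<open>One separated pair exists because a suitable three-point structure embeds. Any two
  loop-free points span an edgeless substructure, so homogeneity carries that pair, together with
  its separating point, to any other.\<close>

lemma mixed_limit_separates:
  assumes M: "homogeneous digraph_sig M" "mixed M"
    and emb: "\<And>A :: nat rel_model. is_model digraph_sig A \<Longrightarrow> finite (univ A) \<Longrightarrow> mixed A \<Longrightarrow>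
      embeddable digraph_sig A M"
    and xy: "x \<in> univ M" "y \<in> univ M" "x \<noteq> y" "\<not> edge M x x" "\<not> edge M y y"
  shows "\<exists>q\<in>univ M. edge M x q \<and> \<not> edge M y q"
proof -
  \<comment> \<open>The points 0 and 1 are loop-free, 2 has a loop, and only 0 is joined to
    2.\<close>
  define T where "T = digraph {0, 1, 2 :: nat} (\<lambda>a b. b = 2 \<and> a \<noteq> 1)"
  have "mixed T" by (rule mixedI) (auto simp: T_def)
  then obtain e where e: "embedding digraph_sig T M e"
    using emb[of T] by (auto simp: T_def is_model_digraph embeddable_def)
  have im: "e 0 \<in> univ M" "e 1 \<in> univ M" "e 2 \<in> univ M"
    using embedding_image[OF e] by (auto simp: T_def)
  have ne: "e 0 \<noteq> e 1" using embedding_inj_on[OF e] by (auto simp: T_def inj_on_def)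
  have ed: "edge M (e a) (e b) \<longleftrightarrow> edge T a b" if "a \<in> univ T" "b \<in> univ T" for a b
    using e that by (simp add: embedding_digraph_iff)
  have no: "\<not> edge M (e a) (e b)" if "a \<in> {0, 1}" "b \<in> {0, 1}" for a b
    using ed[of a b] that by (auto simp: T_def)
  \<comment> \<open>An edge forces a loop at its target.\<close>
  have no': "\<not> edge M x y" "\<not> edge M y x"
    using mixed_loop[OF M(2)] xy by blast+
  let ?f = "\<lambda>z. if z = e 0 then x else y"
  have "isomorphism digraph_sig (induced M {e 0, e 1}) (induced M {x, y}) ?f"
    unfolding isomorphism_def embedding_digraph_iff
    using ne xy no no' by auto
  moreover have "{e 0, e 1} \<subseteq> univ M" "{x, y} \<subseteq> univ M" using im xy by simp_all
  ultimately have "\<exists>g. isomorphism digraph_sig M M g \<and> (\<forall>z\<in>{e 0, e 1}. g z = ?f z)"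
    using M(1)[unfolded homogeneous_def, rule_format, of "{e 0, e 1}" "{x, y}" ?f] by simp
  then obtain g where g: "isomorphism digraph_sig M M g" "g (e 0) = x" "g (e 1) = y"
    using ne by auto
  have "edge M (g (e a)) (g (e 2)) \<longleftrightarrow> edge T a 2" if "a \<in> {0, 1}" for a
  proof -
    have "e a \<in> univ M" using im that by auto
    then have "edge M (g (e a)) (g (e 2)) \<longleftrightarrow> edge M (e a) (e 2)"
      using g(1) im(3) by (simp add: isomorphism_def embedding_digraph_iff)
    then show ?thesis using ed[of a 2] that by (auto simp: T_def)
  qed
  from this[of 0] this[of 1] have "edge M x (g (e 2))" "\<not> edge M y (g (e 2))"
    using g by (simp_all add: T_def)
  then show ?thesis using isomorphism_digraph_imp[OF g(1) im(3)] by blast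
qed

theorem theorem2:
  "\<exists>(L :: signature) (F :: nat rel_model set).
     finite_relational_signature L \<and> fraisse_class L F \<and>
     (\<exists>M :: nat rel_model. fraisse_limit L F M) \<and>
     (\<forall>M :: nat rel_model. fraisse_limit L F M \<longrightarrow>
        torsion_free (automorphism_group L M) \<and>
        (\<forall>n :: nat. \<exists>X. X \<subseteq> univ M \<and> finite X \<and>
           automorphism_group L (induced M X) \<cong> sym_group n))"
proof -
  obtain M0 :: "nat rel_model" where M0: "is_model digraph_sig M0" "mixed M0"
    and ext: "\<And>A :: nat rel_model. mixed A \<Longrightarrow> extension_property A M0"
    using mixed_limit_exists by blast
  let ?F = "age digraph_sig M0"
  have hom: "homogeneous digraph_sig M0"
    by (intro extension_property_homogeneous ext M0) auto
  \<comment> \<open>The claim concerns every limit \<open>M\<close>. Only homogeneity and the age of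
    \<open>M\<close> are used, so no appeal to uniqueness of the limit is made; \<open>M0\<close>
    serves to describe the age.\<close>
  have limit: "torsion_free (automorphism_group digraph_sig M)"
    "\<exists>X. X \<subseteq> univ M \<and> finite X \<and> automorphism_group digraph_sig (induced M X) \<cong> sym_group n"
    if lim: "fraisse_limit digraph_sig ?F M" for M :: "nat rel_model" and n
  proof -
    have M: "is_model digraph_sig M" "homogeneous digraph_sig M" "age digraph_sig M = ?F"
      using lim by (auto simp: fraisse_limit_def)
    have "mixed (induced M X)" if "X \<subseteq> univ M" "finite X" for X
    proof -
      have "induced M X \<in> ?F" using induced_in_age[OF M(1) that(2,1)] M(3) by simp
      then show ?thesis using mixed_embedding M0(2) by (auto simp: age_def embeddable_def)
    qed
    then have "mixed M" by (rule mixed_if_mixed_induced)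
    have emb: "embeddable digraph_sig A M"
      if "is_model digraph_sig A" "finite (univ A)" "mixed A" for A :: "nat rel_model"
    proof -
      have "embeddable digraph_sig A M0"
        using extension_property_embeddable[OF ext[OF that(3)] that(2)] .
      then have "A \<in> age digraph_sig M"
        unfolding M(3) using that by (simp add: age_def finite_models_def)
      then show ?thesis by (simp add: age_def)
    qed
    show "torsion_free (automorphism_group digraph_sig M)"
      using torsion_free_automorphism_group[OF \<open>mixed M\<close>]
        mixed_limit_separates[OF M(2) \<open>mixed M\<close> emb] by blast
    \<comment> \<open>A structure of \<open>n\<close> loop-free points satisfies the axioms of
      \<open>mixed\<close>, so a copy of it lies in \<open>M\<close>.\<close>
    let ?D = "digraph {1..n} (\<lambda>_ _. False)"
    have "mixed ?D" by (rule mixedI) auto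
    then obtain e where e: "embedding digraph_sig ?D M e"
      using emb[of ?D] by (auto simp: is_model_digraph embeddable_def)
    let ?X = "e ` {1..n}"
    have "card ?X = n" using embedding_inj_on[OF e] by (simp add: card_image)
    moreover have "\<not> edge M x y" if "x \<in> ?X" "y \<in> ?X" for x y
      using e that by (auto simp: embedding_digraph_iff)
    ultimately have "automorphism_group digraph_sig (induced M ?X) \<cong> sym_group n"
      by (intro automorphism_group_edgeless) auto
    moreover have "?X \<subseteq> univ M" using embedding_image[OF e] by simp
    ultimately show "\<exists>X. X \<subseteq> univ M \<and> finite X \<and>
        automorphism_group digraph_sig (induced M X) \<cong> sym_group n"
      by (intro exI[of _ ?X]) simp
  qed
  have "finite_relational_signature digraph_sig"
    by (simp add: finite_relational_signature_def digraph_sig_def)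
  moreover have "fraisse_class digraph_sig ?F"
    by (rule fraisse_class_age[OF M0(1) hom]) (simp add: digraph_sig_def)
  moreover have "fraisse_limit digraph_sig ?F M0"
    using M0(1) hom by (simp add: fraisse_limit_def)
  ultimately show ?thesis
    using limit by (intro exI[of _ digraph_sig] exI[of _ ?F]) blast
qed

end
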